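(* Let $\mathcal X\subseteq\mathbb R^d$ and $\mathcal Y\subseteq\mathbb R^n$ be nonempty, compact, convex sets, let $\psi:\mathbb R^d\times\mathbb R^n\to\mathbb R$ be differentiable and convex-concave, let $\|\cdot\|$ be a norm on $\mathbb R^n$, and let $r:\mathbb R^n\to\mathbb R$ be differentiable and $\mu_r$-strongly convex with respect to $\|\cdot\|$ for some $\mu_r>0$. Let $y_0\in\mathcal Y$, $K\in\mathbb N$, $\lambda_0,\dots,\lambda_{K-1}>0$ and $\epsilon_1,\dots,\epsilon_K>0$, and let $y_K$ be the output of the dual-extraction procedure described in the context run with these inputs. Let $y^\star\in\operatorname{argmax}_{y\in\mathcal Y}\phi(y)$ and $\Lambda_k:=\sum_{j=0}^{k-1}\lambda_j$ for $k\in\{1,\dots,K\}$. Then there is a point $u\in\mathcal Y$ such that $$V_{y_K}(u)\le\frac{\epsilon_K}{\Lambda_K}\qquad\text{and}\qquad \phi(y^\star)-\phi(u)\le\lambda_0V_{y_0}(y^\star)+\sum_{k=1}^{K-1}\frac{\lambda_k}{\Lambda_k}\epsilon_k .$$ If additionally $\phi$ is $L$-Lipschitz with respect to $\|\cdot\|$, then $$\phi(y^\star)-\phi(y_K)\le\lambda_0V_{y_0}(y^\star)+\sum_{k=1}^{K-1}\frac{\lambda_k}{\Lambda_k}\epsilon_k+L\sqrt{\frac{2}{\mu_r}\cdot\frac{\epsilon_K}{\Lambda_K}} .$$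
   Context: Convex-concave means $\psi(\cdot,y)$ is convex for every fixed $y$ and $\psi(x,\cdot)$ is concave for every fixed $x$. The primal function is $f(x):=\max_{y\in\mathcal Y}\psi(x,y)$ on $\mathcal X$ and the dual function is $\phi(y):=\min_{x\in\mathcal X}\psi(x,y)$ on $\mathcal Y$. The Bregman divergence of $r$ is $V_u(v):=r(v)-r(u)-\langle\nabla r(u),v-u\rangle$. Dual-extraction procedure. Set $\psi_0:=\psi$, $f_0:=f$, $\phi_0:=\phi$. For $k=1,2,\dots,K$: define $$\psi_k(x,y):=\psi_{k-1}(x,y)-\lambda_{k-1}V_{y_{k-1}}(y),\quad f_k(x):=\max_{y\in\mathcal Y}\psi_k(x,y),\quad \phi_k(y):=\min_{x\in\mathcal X}\psi_k(x,y);$$ let $x_k\in\mathcal X$ be any point with $f_k(x_k)-\min_{x\in\mathcal X}f_k(x)\le\epsilon_k$; and let $y_k:=\operatorname{argmax}_{y\in\mathcal Y}\psi_k(x_k,y)$. Return $y_K$. *)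

theory Defs
  imports "HOL-Analysis.Analysis"
begin

(* An arbitrary norm; the type-class norm on real ^ 'n is the Euclidean one only. *)
definition is_norm :: "('b::real_vector \<Rightarrow> real) \<Rightarrow> bool" where
  "is_norm N \<longleftrightarrow>
     (\<forall>v. 0 \<le> N v) \<and> (\<forall>v. N v = 0 \<longleftrightarrow> v = 0) \<and>
     (\<forall>c v. N (c *\<^sub>R v) = \<bar>c\<bar> * N v) \<and> (\<forall>v w. N (v + w) \<le> N v + N w)"

definition strongly_convex_wrt :: "('b::real_vector \<Rightarrow> real) \<Rightarrow> real \<Rightarrow> ('b \<Rightarrow> real) \<Rightarrow> bool" where
  "strongly_convex_wrt N mu r \<longleftrightarrow>
     (\<forall>u v t. 0 \<le> t \<and> t \<le> 1 \<longrightarrow>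
        r ((1 - t) *\<^sub>R u + t *\<^sub>R v)
          \<le> (1 - t) * r u + t * r v - mu / 2 * t * (1 - t) * (N (u - v))\<^sup>2)"

(* lipschitz_on is tied to the type-class metric, so it does not cover an arbitrary norm N.
   As there, the constant is nonnegative. *)
definition lipschitz_wrt :: "('b::real_vector \<Rightarrow> real) \<Rightarrow> real \<Rightarrow> 'b set \<Rightarrow> ('b \<Rightarrow> real) \<Rightarrow> bool" where
  "lipschitz_wrt N L S g \<longleftrightarrow> 0 \<le> L \<and> (\<forall>u\<in>S. \<forall>v\<in>S. \<bar>g u - g v\<bar> \<le> L * N (u - v))"

definition convex_concave :: "('a::real_vector \<Rightarrow> 'b::real_vector \<Rightarrow> real) \<Rightarrow> bool" where
  "convex_concave \<psi> \<longleftrightarrow>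
     (\<forall>y. convex_on UNIV (\<lambda>x. \<psi> x y)) \<and> (\<forall>x. concave_on UNIV (\<lambda>y. \<psi> x y))"

(* Unique, hence meaningful, wherever r is differentiable (on a Euclidean space). *)
definition gradient :: "('b::real_inner \<Rightarrow> real) \<Rightarrow> 'b \<Rightarrow> 'b" where
  "gradient r u = (THE g. GDERIV r u :> g)"

definition bregman :: "('b::real_inner \<Rightarrow> real) \<Rightarrow> 'b \<Rightarrow> 'b \<Rightarrow> real" where
  "bregman r u v = r v - r u - gradient r u \<bullet> (v - u)"

(* In the next two definitions, and for the minimum of f_k below, the supremum/infimum is
   attained, hence a max/min, when X and Y are nonempty and compact and \<psi> is continuous. *)
definition primal_fun :: "'b set \<Rightarrow> ('a \<Rightarrow> 'b \<Rightarrow> real) \<Rightarrow> 'a \<Rightarrow> real" where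
  "primal_fun Y \<psi> x = (SUP y\<in>Y. \<psi> x y)"

definition dual_fun :: "'a set \<Rightarrow> ('a \<Rightarrow> 'b \<Rightarrow> real) \<Rightarrow> 'b \<Rightarrow> real" where
  "dual_fun X \<psi> y = (INF x\<in>X. \<psi> x y)"

(* psi_seq \<psi> r lam y k is the k-th regularized objective; it depends only on y 0, ..., y (k - 1). *)
primrec psi_seq ::
  "('a \<Rightarrow> 'b::real_inner \<Rightarrow> real) \<Rightarrow> ('b \<Rightarrow> real) \<Rightarrow> (nat \<Rightarrow> real) \<Rightarrow> (nat \<Rightarrow> 'b) \<Rightarrow> nat \<Rightarrow> 'a \<Rightarrow> 'b \<Rightarrow> real"
where
  "psi_seq \<psi> r lam y 0 = \<psi>"
| "psi_seq \<psi> r lam y (Suc k) = (\<lambda>x v. psi_seq \<psi> r lam y k x v - lam k * bregman r (y k) v)"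

(* The sequences x 1, ..., x K and y 0, ..., y K form a run of the dual-extraction procedure.
   It is a relation because x k may be any eps k-approximate minimizer of f_k; the output is y K.
   Values of the sequences at other indices are irrelevant. *)
definition dual_extraction_run ::
  "'a set \<Rightarrow> 'b::real_inner set \<Rightarrow> ('a \<Rightarrow> 'b \<Rightarrow> real) \<Rightarrow> ('b \<Rightarrow> real) \<Rightarrow> nat \<Rightarrow> (nat \<Rightarrow> real) \<Rightarrow>
   (nat \<Rightarrow> real) \<Rightarrow> 'b \<Rightarrow> (nat \<Rightarrow> 'a) \<Rightarrow> (nat \<Rightarrow> 'b) \<Rightarrow> bool"
where
  "dual_extraction_run X Y \<psi> r K lam eps y0 x y \<longleftrightarrow>
     y 0 = y0 \<and>
     (\<forall>k\<in>{1..K}.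
        let \<psi>k = psi_seq \<psi> r lam y k; fk = primal_fun Y \<psi>k in
        x k \<in> X \<and> fk (x k) - (INF z\<in>X. fk z) \<le> eps k \<and>
        is_arg_max (\<psi>k (x k)) (\<lambda>v. v \<in> Y) (y k))"

end

theory Submission
  imports Defs
begin

text \<open>
  Write \<open>S\<^sub>k(v)\<close> (\<open>bregman_penalty\<close>) for the accumulated regularizer \<open>\<Sum>j<k. \<lambda>\<^sub>j V\<^bsub>y\<^sub>j\<^esub>(v)\<close>,
  so that \<open>\<psi>\<^sub>k = \<psi> - S\<^sub>k\<close> and \<open>\<phi>\<^sub>k = \<phi> - S\<^sub>k\<close>.  The point \<open>u\<close> of the theorem is the
  last member \<open>u\<^sub>K\<close> of a shadow sequence: \<open>u\<^sub>k\<close> maximizes \<open>\<phi>\<^sub>k\<close> over \<open>Y\<close>, and \<open>u\<^sub>0 = y\<^sup>\<star>\<close>.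

  The computed \<open>y\<^sub>k\<close> stays close to \<open>u\<^sub>k\<close>.  Up to an affine function \<open>S\<^sub>k\<close> is \<open>\<Lambda>\<^sub>k r\<close>, so
  \<open>\<psi>\<^sub>k(x\<^sub>k, \<cdot>)\<close> drops below its maximal value \<open>f\<^sub>k(x\<^sub>k)\<close> by at least \<open>\<Lambda>\<^sub>k V\<^bsub>y\<^sub>k\<^esub>(u)\<close> at every
  \<open>u \<in> Y\<close> (\<open>concave_minus_bregman_penalty_drop\<close>).  At \<open>u = u\<^sub>k\<close> the value cannot be
  lower than \<open>\<phi>\<^sub>k(u\<^sub>k)\<close>, and by strong duality this is \<open>min f\<^sub>k \<ge> f\<^sub>k(x\<^sub>k) - \<epsilon>\<^sub>k\<close>; hence
  \<open>\<Lambda>\<^sub>k V\<^bsub>y\<^sub>k\<^esub>(u\<^sub>k) \<le> \<epsilon>\<^sub>k\<close> (\<open>extraction_stage\<close>).  Strong duality comes from an elementary saddle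
  point argument (\<open>saddle_point_of_unique_maximizers\<close>): by the same drop, \<open>\<psi>\<^sub>k(x, \<cdot>)\<close> has only
  one maximizer over \<open>Y\<close>.

  The values telescope, because replacing \<open>u\<^sub>k\<close> by \<open>u\<^sub>k\<^sub>+\<^sub>1\<close> can only increase \<open>\<phi>\<^sub>k\<^sub>+\<^sub>1\<close>:
  \<open>\<phi>\<^sub>k\<^sub>+\<^sub>1(u\<^sub>k\<^sub>+\<^sub>1) \<ge> \<phi>\<^sub>k\<^sub>+\<^sub>1(u\<^sub>k) = \<phi>\<^sub>k(u\<^sub>k) - \<lambda>\<^sub>k V\<^bsub>y\<^sub>k\<^esub>(u\<^sub>k)\<close>.  Since \<open>\<phi> \<ge> \<phi>\<^sub>K\<close>, this bounds
  \<open>\<phi>(y\<^sup>\<star>) - \<phi>(u\<^sub>K)\<close> by \<open>\<lambda>\<^sub>0 V\<^bsub>y\<^sub>0\<^esub>(y\<^sup>\<star>)\<close> and the errors \<open>\<lambda>\<^sub>k V\<^bsub>y\<^sub>k\<^esub>(u\<^sub>k) \<le> (\<lambda>\<^sub>k / \<Lambda>\<^sub>k) \<epsilon>\<^sub>k\<close>.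
  Strong convexity of \<open>r\<close> turns the bound on \<open>V\<^bsub>y\<^sub>K\<^esub>(u\<^sub>K)\<close> into a bound on the distance from \<open>u\<^sub>K\<close>
  to \<open>y\<^sub>K\<close>, which gives the Lipschitz version.
\<close>

section \<open>Bregman divergences of strongly convex functions\<close>

lemma directional_derivative_at_right:
  fixes f :: "'a::real_normed_vector \<Rightarrow> real"
  assumes "(f has_derivative D) (at a)"
  shows "((\<lambda>t. (f (a + t *\<^sub>R h) - f a) / t) \<longlongrightarrow> D h) (at_right 0)"
proof -
  interpret D: bounded_linear D using assms by (rule has_derivative_bounded_linear)
  have "((\<lambda>t::real. a + t *\<^sub>R h) has_derivative (\<lambda>t. t *\<^sub>R h)) (at 0)"
    by (auto intro!: derivative_eq_intros)
  moreover have "(f has_derivative D) (at (a + 0 *\<^sub>R h))" using assms by simp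
  ultimately have "((\<lambda>t. f (a + t *\<^sub>R h)) has_derivative (\<lambda>t. D (t *\<^sub>R h))) (at 0)"
    by (rule has_derivative_compose)
  then have "((\<lambda>t. f (a + t *\<^sub>R h)) has_real_derivative D h) (at 0)"
    by (simp add: has_field_derivative_def D.scaleR mult_commute_abs)
  then have "((\<lambda>t. (f (a + t *\<^sub>R h) - f a) / t) \<longlongrightarrow> D h) (at 0)"
    by (simp add: DERIV_def)
  then show ?thesis by (rule filterlim_mono) (auto simp: at_le)
qed

lemma has_derivative_gradient:
  fixes r :: "'b::euclidean_space \<Rightarrow> real"
  assumes "r differentiable (at u)"
  shows "(r has_derivative (\<lambda>h. gradient r u \<bullet> h)) (at u)"
proof -
  obtain D where D: "(r has_derivative D) (at u)"
    using assms by (auto simp: differentiable_def)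
  have "linear D" using D by (rule has_derivative_linear)
  then have "D h = h \<bullet> adjoint D 1" for h using adjoint_works[of D h 1] by simp
  then have "D = (\<lambda>h. h \<bullet> adjoint D 1)" by blast
  then have "GDERIV r u :> adjoint D 1" using D by (simp add: gderiv_def)
  moreover have "g = g'" if "GDERIV r u :> g" "GDERIV r u :> g'" for g g'
    using has_derivative_unique[OF that[unfolded gderiv_def]]
    by (metis inner_commute vector_eq_rdot)
  ultimately have "GDERIV r u :> gradient r u"
    unfolding gradient_def by (metis the_equality)
  then show ?thesis by (simp add: gderiv_def inner_commute)
qed

text \<open>
  Strong convexity on the segment from \<open>u\<close> to \<open>v\<close> bounds the difference quotients of \<open>r\<close> at \<open>u\<close>
  in direction \<open>v - u\<close>; at step length \<open>t\<close> the quadratic term carries a factor \<open>1 - t\<close>, which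
  disappears in the limit.
\<close>
lemma bregman_ge_square:
  fixes r :: "'b::euclidean_space \<Rightarrow> real"
  assumes "r differentiable (at u)" and sc: "strongly_convex_wrt N mu r"
  shows "mu / 2 * (N (u - v))\<^sup>2 \<le> bregman r u v"
proof -
  let ?c = "mu / 2 * (N (u - v))\<^sup>2"
  have lim: "((\<lambda>t. (r (u + t *\<^sub>R (v - u)) - r u) / t) \<longlongrightarrow> gradient r u \<bullet> (v - u)) (at_right 0)"
    using directional_derivative_at_right[OF has_derivative_gradient[OF assms(1)]] .
  have lim': "((\<lambda>t. r v - r u - (1 - t) * ?c) \<longlongrightarrow> r v - r u - (1 - 0) * ?c) (at_right 0)"
    by (intro tendsto_intros)
  have "eventually (\<lambda>t. (r (u + t *\<^sub>R (v - u)) - r u) / t \<le> r v - r u - (1 - t) * ?c) (at_right (0::real))"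
    using eventually_at_right_less[of "0::real"] eventually_at_right_real[of 0 "1::real", simplified]
  proof eventually_elim
    case (elim t)
    have eq: "u + t *\<^sub>R (v - u) = (1 - t) *\<^sub>R u + t *\<^sub>R v" by (simp add: algebra_simps)
    have "r ((1 - t) *\<^sub>R u + t *\<^sub>R v) \<le> (1 - t) * r u + t * r v - mu / 2 * t * (1 - t) * (N (u - v))\<^sup>2"
      using sc elim by (simp add: strongly_convex_wrt_def)
    then have "r (u + t *\<^sub>R (v - u)) - r u \<le> (r v - r u - (1 - t) * ?c) * t"
      by (simp add: eq algebra_simps)
    then show ?case using elim by (simp add: pos_divide_le_eq)
  qed
  from tendsto_le[OF _ lim' lim this] show ?thesis by (simp add: bregman_def)
qed

lemma
  fixes r :: "'b::euclidean_space \<Rightarrow> real"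
  assumes "is_norm N" "mu > 0" "strongly_convex_wrt N mu r" "r differentiable (at u)"
  shows bregman_nonneg: "0 \<le> bregman r u v"
    and bregman_pos: "u \<noteq> v \<Longrightarrow> 0 < bregman r u v"
proof -
  note ge = bregman_ge_square[OF assms(4,3), of v]
  show "0 \<le> bregman r u v" using assms(2) by (intro order_trans[OF _ ge]) simp
  assume "u \<noteq> v"
  then have "N (u - v) \<noteq> 0" using assms(1) unfolding is_norm_def by simp
  then show "0 < bregman r u v" using assms(2) by (intro less_le_trans[OF _ ge]) simp
qed

lemma bregman_three_point:
  "bregman r a u - bregman r a b
     = bregman r b u + (gradient r b - gradient r a) \<bullet> (u - b)"
  by (simp add: bregman_def algebra_simps inner_diff_left inner_diff_right)

lemma has_derivative_bregman:
  fixes r :: "'b::euclidean_space \<Rightarrow> real"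
  assumes "r differentiable (at b)"
  shows "(bregman r a has_derivative (\<lambda>h. (gradient r b - gradient r a) \<bullet> h)) (at b)"
  unfolding bregman_def
  by (auto intro!: derivative_eq_intros has_derivative_gradient[OF assms] simp: inner_diff_left)

definition bregman_penalty ::
  "('b::real_inner \<Rightarrow> real) \<Rightarrow> (nat \<Rightarrow> real) \<Rightarrow> (nat \<Rightarrow> 'b) \<Rightarrow> nat \<Rightarrow> 'b \<Rightarrow> real" where
  "bregman_penalty r lam y k v = (\<Sum>j<k. lam j * bregman r (y j) v)"

lemma psi_seq_eq: "psi_seq \<psi> r lam y k x v = \<psi> x v - bregman_penalty r lam y k v"
  by (induction k) (simp_all add: bregman_penalty_def)

lemma continuous_on_bregman_penalty:
  fixes r :: "'b::euclidean_space \<Rightarrow> real"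
  assumes "r differentiable_on UNIV"
  shows "continuous_on A (bregman_penalty r lam y k)"
proof -
  have "continuous_on A r"
    using differentiable_imp_continuous_on[OF assms] continuous_on_subset by blast
  then show ?thesis unfolding bregman_penalty_def bregman_def by (intro continuous_intros)
qed

section \<open>Maximizing a concave function minus a Bregman penalty\<close>

text \<open>
  Only the subtracted part is differentiated: on the segment from \<open>b\<close> to \<open>u\<close> the function \<open>g\<close>
  lies above its chord, and maximality at \<open>b\<close> forces the chord to rise no faster than \<open>S\<close>.
\<close>
lemma maximizer_first_order:
  fixes S :: "'b::real_normed_vector \<Rightarrow> real"
  assumes "convex Y" "concave_on Y g" "(S has_derivative D) (at b)"
    and "b \<in> Y" "u \<in> Y" and max: "\<And>v. v \<in> Y \<Longrightarrow> g v - S v \<le> g b - S b"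
  shows "g u - g b \<le> D (u - b)"
proof -
  have "eventually (\<lambda>t. g u - g b \<le> (S (b + t *\<^sub>R (u - b)) - S b) / t) (at_right (0::real))"
    using eventually_at_right_less[of "0::real"] eventually_at_right_real[of 0 "1::real", simplified]
  proof eventually_elim
    case (elim t)
    have eq: "b + t *\<^sub>R (u - b) = (1 - t) *\<^sub>R b + t *\<^sub>R u" by (simp add: algebra_simps)
    have "(1 - t) *\<^sub>R b + t *\<^sub>R u \<in> Y"
      using assms(1,4,5) elim by (intro convexD) auto
    from max[OF this] have "g ((1 - t) *\<^sub>R b + t *\<^sub>R u) - S (b + t *\<^sub>R (u - b)) \<le> g b - S b"
      by (simp add: eq)
    moreover have "(1 - t) * g b + t * g u \<le> g ((1 - t) *\<^sub>R b + t *\<^sub>R u)"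
      using concave_onD[OF assms(2), of t b u] assms(4,5) elim by simp
    ultimately have "(g u - g b) * t \<le> S (b + t *\<^sub>R (u - b)) - S b"
      by (simp add: algebra_simps)
    then show ?case using elim by (simp add: pos_le_divide_eq)
  qed
  from tendsto_lowerbound[OF directional_derivative_at_right[OF assms(3)] this] show ?thesis
    by simp
qed

text \<open>
  Every \<open>bregman r (y j)\<close> differs from \<open>r\<close> by an affine function, so the gap between the penalty
  and its linearization at \<open>b\<close> is the total weight times \<open>bregman r b u\<close>, whatever the centres
  \<open>y j\<close> are; the first-order condition bounds everything else.
\<close>
lemma concave_minus_bregman_penalty_drop:
  fixes r :: "'b::euclidean_space \<Rightarrow> real"
  assumes "convex Y" "concave_on Y g" "r differentiable (at b)" "b \<in> Y" "u \<in> Y"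
    and max: "\<And>v. v \<in> Y \<Longrightarrow>
      g v - bregman_penalty r lam y k v \<le> g b - bregman_penalty r lam y k b"
  shows "g u - bregman_penalty r lam y k u
    \<le> g b - bregman_penalty r lam y k b - (\<Sum>j<k. lam j) * bregman r b u"
proof -
  let ?D = "\<lambda>h. \<Sum>j<k. lam j * ((gradient r b - gradient r (y j)) \<bullet> h)"
  have "(bregman_penalty r lam y k has_derivative ?D) (at b)"
    unfolding bregman_penalty_def[abs_def]
    by (intro has_derivative_sum has_derivative_mult_right has_derivative_bregman assms(3))
  then have "g u - g b \<le> ?D (u - b)"
    using maximizer_first_order assms(1,2,4,5) max by blast
  moreover have "bregman_penalty r lam y k u - bregman_penalty r lam y k b
      = (\<Sum>j<k. lam j * (bregman r (y j) u - bregman r (y j) b))"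
    by (simp add: bregman_penalty_def sum_subtractf right_diff_distrib)
  then have "bregman_penalty r lam y k u - bregman_penalty r lam y k b
      = (\<Sum>j<k. lam j) * bregman r b u + ?D (u - b)"
    by (simp add: bregman_three_point distrib_left sum.distrib sum_distrib_right)
  ultimately show ?thesis by simp
qed

section \<open>A saddle point from unique maximizers\<close>

lemma continuous_on_slices:
  assumes "continuous_on (X \<times> Y) (\<lambda>(a, b). F a b)"
  shows "a \<in> X \<Longrightarrow> continuous_on Y (F a)"
    and "b \<in> Y \<Longrightarrow> continuous_on X (\<lambda>a. F a b)"
proof -
  show "continuous_on Y (F a)" if "a \<in> X"
  proof -
    have "continuous_on Y (Pair a)" "Pair a ` Y \<subseteq> X \<times> Y"
      using that by (auto intro!: continuous_intros)
    from continuous_on_compose2[OF assms this] show ?thesis by simp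
  qed
  show "continuous_on X (\<lambda>a. F a b)" if "b \<in> Y"
  proof -
    have "continuous_on X (\<lambda>a. (a, b))" "(\<lambda>a. (a, b)) ` X \<subseteq> X \<times> Y"
      using that by (auto intro!: continuous_intros)
    from continuous_on_compose2[OF assms this] show ?thesis by simp
  qed
qed

text \<open>
  For a fixed \<open>b\<close>, the bound on \<open>F (z n) b\<close> along a minimizing sequence \<open>z\<close> of the upper envelope
  passes to a limit point of \<open>z\<close>, by continuity; the supremum over \<open>b\<close>
  is taken only afterwards.
\<close>
lemma attains_min_of_max:
  fixes F :: "'a::metric_space \<Rightarrow> 'b::metric_space \<Rightarrow> real"
  assumes X: "X \<noteq> {}" "compact X" and Y: "Y \<noteq> {}" "compact Y"
    and cont: "continuous_on (X \<times> Y) (\<lambda>(a, b). F a b)"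
  shows "\<exists>a\<in>X. \<forall>x\<in>X. primal_fun Y F a \<le> primal_fun Y F x"
proof -
  have contY: "continuous_on Y (F a)" if "a \<in> X" for a
    using cont that by (rule continuous_on_slices)
  have contX: "continuous_on X (\<lambda>a. F a b)" if "b \<in> Y" for b
    using cont that by (rule continuous_on_slices)
  have le: "F a b \<le> primal_fun Y F a" if "a \<in> X" "b \<in> Y" for a b
    unfolding primal_fun_def
    using that compact_continuous_image[OF contY Y(2)]
    by (intro cSUP_upper bounded_imp_bdd_above compact_imp_bounded)
  obtain b0 where b0: "b0 \<in> Y" using Y by blast
  obtain c where c: "\<And>a. a \<in> X \<Longrightarrow> c \<le> F a b0"
    using continuous_attains_inf[OF X(2,1) contX[OF b0]] by blast
  have bdd: "bdd_below (primal_fun Y F ` X)"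
    by (rule bdd_belowI2[of _ c]) (use c le b0 order_trans in blast)
  define m where "m = (INF a\<in>X. primal_fun Y F a)"
  have "\<exists>a\<in>X. primal_fun Y F a < m + inverse (real (Suc n))" for n
    using cINF_less_iff[OF X(1) bdd, of "m + inverse (real (Suc n))"] by (simp add: m_def)
  then obtain z where z: "\<And>n. z n \<in> X" "\<And>n. primal_fun Y F (z n) < m + inverse (real (Suc n))"
    by metis
  obtain a s where a: "a \<in> X" "strict_mono s" "(z \<circ> s) \<longlonglongrightarrow> a"
    using X(2) z(1) unfolding compact_def by meson
  have "F a b \<le> m" if "b \<in> Y" for b
  proof (rule LIMSEQ_le)
    show "(\<lambda>n. F ((z \<circ> s) n) b) \<longlonglongrightarrow> F a b"
      using continuous_on_tendsto_compose[OF contX[OF that] a(3,1)] z(1) by simp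
    have "(\<lambda>n. m + inverse (real (Suc n))) \<longlonglongrightarrow> m"
      using LIMSEQ_inverse_real_of_nat_add[of m] by simp
    from LIMSEQ_subseq_LIMSEQ[OF this a(2)]
    show "(\<lambda>n. m + inverse (real (Suc (s n)))) \<longlonglongrightarrow> m" by (simp add: o_def)
    show "\<exists>N. \<forall>n\<ge>N. F ((z \<circ> s) n) b \<le> m + inverse (real (Suc (s n)))"
      using le[OF z(1) that] z(2) by (metis comp_apply less_eq_real_def order_trans)
  qed
  then have "primal_fun Y F a \<le> m" unfolding primal_fun_def using Y(1) by (intro cSUP_least)
  moreover have "m \<le> primal_fun Y F x" if "x \<in> X" for x
    unfolding m_def using bdd that by (rule cINF_lower)
  ultimately show ?thesis using a(1) order_trans by blast
qed

text \<open>
  Let \<open>a\<close> minimize the upper envelope \<open>f = primal_fun Y F\<close>, and move from \<open>a\<close> a little way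
  towards another point \<open>x\<close>.  At a maximizer \<open>w\<close> for the moved point, convexity in the first
  argument and minimality of \<open>a\<close> give \<open>F x w \<ge> f a\<close>.  As the moved point returns to \<open>a\<close>, these
  maximizers accumulate at a maximizer for \<open>a\<close>.  In general that limit depends on \<open>x\<close>; since the
  maximizer for \<open>a\<close> is unique, one \<open>b\<close> serves all \<open>x\<close>.
\<close>
lemma saddle_point_of_unique_maximizers:
  fixes F :: "'a::real_normed_vector \<Rightarrow> 'b::metric_space \<Rightarrow> real"
  assumes X: "X \<noteq> {}" "compact X" "convex X" and Y: "Y \<noteq> {}" "compact Y"
    and cont: "continuous_on (X \<times> Y) (\<lambda>(a, b). F a b)"
    and conv: "\<And>b. b \<in> Y \<Longrightarrow> convex_on X (\<lambda>a. F a b)"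
    and uniq: "\<And>a b b'. \<lbrakk>a \<in> X; b \<in> Y; b' \<in> Y; \<forall>v\<in>Y. F a v \<le> F a b; \<forall>v\<in>Y. F a v \<le> F a b'\<rbrakk>
      \<Longrightarrow> b = b'"
  shows "\<exists>a\<in>X. \<exists>b\<in>Y. (\<forall>v\<in>Y. F a v \<le> F a b) \<and> (\<forall>x\<in>X. F a b \<le> F x b)"
proof -
  have contY: "continuous_on Y (F a)" if "a \<in> X" for a
    using cont that by (rule continuous_on_slices)
  have "\<exists>b\<in>Y. \<forall>v\<in>Y. F a v \<le> F a b" if "a \<in> X" for a
    using continuous_attains_sup[OF Y(2,1) contY[OF that]] by blast
  then obtain w where w: "\<And>a. a \<in> X \<Longrightarrow> w a \<in> Y" "\<And>a v. \<lbrakk>a \<in> X; v \<in> Y\<rbrakk> \<Longrightarrow> F a v \<le> F a (w a)"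
    by metis
  have f: "primal_fun Y F a = F a (w a)" if "a \<in> X" for a
    unfolding primal_fun_def using w that by (intro cSup_eq_maximum) auto
  obtain a where a: "a \<in> X" "\<And>x. x \<in> X \<Longrightarrow> F a (w a) \<le> F x (w x)"
    using attains_min_of_max[OF X(1,2) Y cont] f by metis
  have "F a (w a) \<le> F x (w a)" if x: "x \<in> X" for x
  proof -
    define t :: "nat \<Rightarrow> real" where "t n = inverse (real (Suc n))" for n
    define p where "p n = (1 - t n) *\<^sub>R a + t n *\<^sub>R x" for n
    have t: "0 < t n" "t n \<le> 1" for n by (auto simp: t_def inverse_le_1_iff)
    have pX: "p n \<in> X" for n
      unfolding p_def using X(3) a(1) x t[of n] by (intro convexD) auto
    have far: "F a (w a) \<le> F x (w (p n))" for n
    proof -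
      have "F a (w a) \<le> F (p n) (w (p n))" using a(2) pX by blast
      also have "\<dots> \<le> (1 - t n) * F a (w (p n)) + t n * F x (w (p n))"
        unfolding p_def
        using convex_onD[OF conv[OF w(1)[OF pX]], of "t n" a x] t[of n] a(1) x
        by (simp add: p_def)
      also have "\<dots> \<le> (1 - t n) * F a (w a) + t n * F x (w (p n))"
        using w(2)[OF a(1) w(1)[OF pX]] t[of n] by (simp add: mult_left_mono)
      finally have "t n * F a (w a) \<le> t n * F x (w (p n))" by (simp add: algebra_simps)
      then show ?thesis using t(1)[of n] by simp
    qed
    obtain b s where b: "b \<in> Y" "strict_mono s" "((\<lambda>n. w (p n)) \<circ> s) \<longlonglongrightarrow> b"
      using Y(2) w(1)[OF pX] unfolding compact_def by meson
    have "t \<longlonglongrightarrow> 0" unfolding t_def by (rule LIMSEQ_inverse_real_of_nat)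
    then have "p \<longlonglongrightarrow> (1 - 0) *\<^sub>R a + 0 *\<^sub>R x" unfolding p_def by (intro tendsto_intros)
    then have ps: "(p \<circ> s) \<longlonglongrightarrow> a" using LIMSEQ_subseq_LIMSEQ[OF _ b(2)] by force
    have "(\<lambda>n. ((p \<circ> s) n, ((\<lambda>n. w (p n)) \<circ> s) n)) \<longlonglongrightarrow> (a, b)"
      using ps b(3) by (rule tendsto_Pair)
    from continuous_on_tendsto_compose[OF cont this]
    have "(\<lambda>n. F (p (s n)) (w (p (s n)))) \<longlonglongrightarrow> F a b"
      using a(1) b(1) pX w(1)[OF pX] by simp
    then have "F a (w a) \<le> F a b"
      by (rule LIMSEQ_le_const) (use a(2) pX in blast)
    then have "\<forall>v\<in>Y. F a v \<le> F a b" using w(2)[OF a(1)] order_trans by blast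
    then have "b = w a" using uniq a(1) b(1) w by blast
    moreover have "(\<lambda>n. F x (w (p (s n)))) \<longlonglongrightarrow> F x b"
      using continuous_on_tendsto_compose[OF contY[OF x] b(3,1)] w(1)[OF pX] by simp
    then have "F a (w a) \<le> F x b"
      by (rule LIMSEQ_le_const) (use far in blast)
    ultimately show ?thesis by simp
  qed
  then show ?thesis using a(1) w by blast
qed

section \<open>The dual-extraction procedure\<close>

text \<open>
  The existence of a shadow point for one stage: \<open>u\<close> is the second component of a saddle point
  of \<open>psi_seq \<psi> r lam y k\<close>.  Being a saddle point makes it a maximizer of the regularized dual
  function and makes its value there the minimum of the primal function, which
  \<open>x'\<close> approximates; the drop at \<open>u\<close> from the maximizer \<open>y'\<close> is then at most \<open>e\<close>.
\<close>
lemma extraction_stage: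
  fixes \<psi> :: "'a::euclidean_space \<Rightarrow> 'b::euclidean_space \<Rightarrow> real"
  assumes X: "X \<noteq> {}" "compact X" "convex X" and Y: "Y \<noteq> {}" "compact Y" "convex Y"
    and cont: "continuous_on UNIV (\<lambda>(a, b). \<psi> a b)" and cc: "convex_concave \<psi>"
    and r: "is_norm N" "mu > 0" "strongly_convex_wrt N mu r" "r differentiable_on UNIV"
    and Lam: "0 < (\<Sum>j<k. lam j)"
    and x': "x' \<in> X"
      "primal_fun Y (psi_seq \<psi> r lam y k) x' - (INF z\<in>X. primal_fun Y (psi_seq \<psi> r lam y k) z) \<le> e"
    and y': "is_arg_max (psi_seq \<psi> r lam y k x') (\<lambda>v. v \<in> Y) y'"
  shows "\<exists>u\<in>Y. (\<forall>v\<in>Y. dual_fun X \<psi> v - bregman_penalty r lam y k v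
                      \<le> dual_fun X \<psi> u - bregman_penalty r lam y k u)
           \<and> (\<Sum>j<k. lam j) * bregman r y' u \<le> e"
proof -
  let ?S = "bregman_penalty r lam y k"
  let ?F = "psi_seq \<psi> r lam y k"
  have rd: "r differentiable (at v)" for v
    using r(4) by (simp add: differentiable_on_def)
  have contXY: "continuous_on (X \<times> Y) (\<lambda>(a, b). \<psi> a b)"
    using cont continuous_on_subset by blast
  have concave: "concave_on Y (\<psi> a)" for a
    using cc Y(3) unfolding convex_concave_def concave_on_def
    by (meson convex_on_subset subset_UNIV)
  have drop: "?F a u \<le> ?F a b - (\<Sum>j<k. lam j) * bregman r b u"
    if "b \<in> Y" "u \<in> Y" "\<forall>v\<in>Y. ?F a v \<le> ?F a b" for a b u
    using concave_minus_bregman_penalty_drop[OF Y(3) concave rd that(1,2)] that(3)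
    by (simp add: psi_seq_eq)
  have "\<exists>a\<in>X. \<exists>b\<in>Y. (\<forall>v\<in>Y. ?F a v \<le> ?F a b) \<and> (\<forall>x\<in>X. ?F a b \<le> ?F x b)"
  proof (rule saddle_point_of_unique_maximizers[OF X Y(1,2)])
    have "continuous_on (X \<times> Y) (\<lambda>p. ?S (snd p))"
      using continuous_on_bregman_penalty[OF r(4)]
      by (rule continuous_on_compose2) (auto intro: continuous_on_snd continuous_on_id)
    with contXY show "continuous_on (X \<times> Y) (\<lambda>(a, b). ?F a b)"
      by (auto simp: psi_seq_eq case_prod_unfold intro!: continuous_intros)
    show "convex_on X (\<lambda>a. ?F a b)" for b
    proof -
      have "convex_on X (\<lambda>a. \<psi> a b)"
        using cc X(3) unfolding convex_concave_def by (meson convex_on_subset subset_UNIV)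
      moreover have "convex_on X (\<lambda>a. - ?S b)" using X(3) by (simp add: convex_on_const)
      ultimately show ?thesis using convex_on_add by (fastforce simp: psi_seq_eq)
    qed
    fix a b b' assume *: "b \<in> Y" "b' \<in> Y" "\<forall>v\<in>Y. ?F a v \<le> ?F a b" "\<forall>v\<in>Y. ?F a v \<le> ?F a b'"
    then have "?F a b = ?F a b'" by (meson order_antisym)
    then have "(\<Sum>j<k. lam j) * bregman r b b' \<le> 0" using drop[OF *(1,2,3)] by linarith
    then show "b = b'"
      using Lam bregman_pos[OF r(1-3) rd, of b b'] mult_pos_pos
      by (metis linorder_not_le)
  qed
  then obtain a u where a: "a \<in> X" and u: "u \<in> Y"
    and au: "\<And>v. v \<in> Y \<Longrightarrow> ?F a v \<le> ?F a u" "\<And>z. z \<in> X \<Longrightarrow> ?F a u \<le> ?F z u" by blast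
  have y'Y: "y' \<in> Y" and y'max: "\<forall>v\<in>Y. ?F x' v \<le> ?F x' y'"
    using y' by (auto simp: is_arg_max_linorder)
  have "dual_fun X \<psi> v - ?S v \<le> dual_fun X \<psi> u - ?S u" if v: "v \<in> Y" for v
  proof -
    have "continuous_on X (\<lambda>z. \<psi> z v)"
      using contXY v by (rule continuous_on_slices)
    then have "bdd_below ((\<lambda>z. \<psi> z v) ` X)"
      using X(2) by (intro bounded_imp_bdd_below compact_imp_bounded compact_continuous_image)
    then have "dual_fun X \<psi> v \<le> \<psi> a v" unfolding dual_fun_def using a by (rule cINF_lower)
    then have "dual_fun X \<psi> v - ?S v \<le> ?F a u" using au(1)[OF v] by (simp add: psi_seq_eq)
    moreover have "?F a u + ?S u \<le> dual_fun X \<psi> u"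
      unfolding dual_fun_def using au(2) X(1) by (intro cINF_greatest) (auto simp: psi_seq_eq)
    ultimately show ?thesis by linarith
  qed
  moreover have "(\<Sum>j<k. lam j) * bregman r y' u \<le> e"
  proof -
    have max_value: "primal_fun Y ?F z = ?F z b" if "b \<in> Y" "\<forall>v\<in>Y. ?F z v \<le> ?F z b" for z b
      unfolding primal_fun_def using that by (intro cSup_eq_maximum) auto
    have bound: "?F a u \<le> primal_fun Y ?F z" if "z \<in> X" for z
    proof -
      have "continuous_on Y (\<psi> z)"
        using contXY that by (rule continuous_on_slices)
      then have "continuous_on Y (?F z)"
        unfolding psi_seq_eq[abs_def]
        by (intro continuous_intros continuous_on_bregman_penalty r(4))
      then obtain b where "b \<in> Y" "\<forall>v\<in>Y. ?F z v \<le> ?F z b"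
        using continuous_attains_sup[OF Y(2,1)] by blast
      with max_value au(2)[OF that] u show ?thesis by fastforce
    qed
    then have "(INF z\<in>X. primal_fun Y ?F z) \<le> primal_fun Y ?F a"
      using a by (intro cINF_lower bdd_belowI2)
    also have "\<dots> = ?F a u" using max_value u au(1) by blast
    also have "\<dots> \<le> ?F x' u" using au(2) x'(1) .
    also have "\<dots> \<le> ?F x' y' - (\<Sum>j<k. lam j) * bregman r y' u"
      using drop[OF y'Y u y'max] .
    finally show ?thesis using x'(2) max_value[OF y'Y y'max] by linarith
  qed
  ultimately show ?thesis using u by blast
qed

theorem theorem1:
  fixes X :: "(real ^ 'd) set" and Y :: "(real ^ 'n) set"
    and \<psi> :: "real ^ 'd \<Rightarrow> real ^ 'n \<Rightarrow> real"
    and N :: "real ^ 'n \<Rightarrow> real" and r :: "real ^ 'n \<Rightarrow> real" and mu :: real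
    and K :: nat and lam eps :: "nat \<Rightarrow> real"
    and x :: "nat \<Rightarrow> real ^ 'd" and y :: "nat \<Rightarrow> real ^ 'n" and y0 ystar :: "real ^ 'n"
  defines "\<phi> \<equiv> dual_fun X \<psi>" and "Lam \<equiv> \<lambda>k::nat. \<Sum>j<k. lam j"
  assumes "X \<noteq> {}" "compact X" "convex X"
    and "Y \<noteq> {}" "compact Y" "convex Y"
    and "(\<lambda>(u, v). \<psi> u v) differentiable_on UNIV" and "convex_concave \<psi>"
    and "is_norm N"
    and "r differentiable_on UNIV" and "mu > 0" and "strongly_convex_wrt N mu r"
    and "y0 \<in> Y" and "K \<ge> 1"
    and "\<And>k. k < K \<Longrightarrow> lam k > 0" and "\<And>k. k \<in> {1..K} \<Longrightarrow> eps k > 0"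
    and "dual_extraction_run X Y \<psi> r K lam eps y0 x y"
    and "is_arg_max \<phi> (\<lambda>v. v \<in> Y) ystar"
  shows "(\<exists>u\<in>Y. bregman r (y K) u \<le> eps K / Lam K \<and>
            \<phi> ystar - \<phi> u \<le> lam 0 * bregman r y0 ystar + (\<Sum>k\<in>{1..<K}. lam k / Lam k * eps k))
       \<and> (\<forall>L. lipschitz_wrt N L Y \<phi> \<longrightarrow>
            \<phi> ystar - \<phi> (y K) \<le> lam 0 * bregman r y0 ystar + (\<Sum>k\<in>{1..<K}. lam k / Lam k * eps k)
              + L * sqrt (2 / mu * (eps K / Lam K)))"
proof -
  let ?S = "bregman_penalty r lam y"
  let ?B = "lam 0 * bregman r y0 ystar + (\<Sum>k\<in>{1..<K}. lam k / Lam k * eps k)"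
  have cont: "continuous_on UNIV (\<lambda>(a, b). \<psi> a b)"
    using assms(9) by (rule differentiable_imp_continuous_on)
  have rd: "r differentiable (at v)" for v
    using assms(12) by (simp add: differentiable_on_def)
  have V: "0 \<le> bregman r v w" for v w
    using bregman_nonneg[OF assms(11,13,14) rd] .
  have y_0: "y 0 = y0" and ystar: "ystar \<in> Y"
    using assms(19,20) by (auto simp: dual_extraction_run_def is_arg_max_def)
  have run: "x k \<in> X" "primal_fun Y (psi_seq \<psi> r lam y k) (x k)
        - (INF z\<in>X. primal_fun Y (psi_seq \<psi> r lam y k) z) \<le> eps k"
      "is_arg_max (psi_seq \<psi> r lam y k (x k)) (\<lambda>v. v \<in> Y) (y k)" if "k \<in> {1..K}" for k
    using assms(19) that by (auto simp: dual_extraction_run_def Let_def)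
  have Lam: "0 < Lam k" if "k \<in> {1..K}" for k
    unfolding Lam_def using that assms(17) by (intro sum_pos) (auto simp: lessThan_empty_iff)
  have "\<exists>u\<in>Y. (\<forall>v\<in>Y. \<phi> v - ?S k v \<le> \<phi> u - ?S k u) \<and> Lam k * bregman r (y k) u \<le> eps k"
    if "k \<in> {1..K}" for k
    using extraction_stage[OF assms(3-8) cont assms(10,11,13,14,12) _ run[OF that]] Lam[OF that]
    by (simp add: \<phi>_def Lam_def)
  then obtain w where w: "\<And>k. k \<in> {1..K} \<Longrightarrow> w k \<in> Y"
      "\<And>k v. \<lbrakk>k \<in> {1..K}; v \<in> Y\<rbrakk> \<Longrightarrow> \<phi> v - ?S k v \<le> \<phi> (w k) - ?S k (w k)"
      "\<And>k. k \<in> {1..K} \<Longrightarrow> Lam k * bregman r (y k) (w k) \<le> eps k"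
    by metis
  have close: "bregman r (y k) (w k) \<le> eps k / Lam k" if "k \<in> {1..K}" for k
    using w(3)[OF that] Lam[OF that] by (simp add: pos_le_divide_eq mult.commute)
  have telescope: "\<phi> ystar - lam 0 * bregman r y0 ystar - (\<Sum>k\<in>{1..<m}. lam k / Lam k * eps k)
      \<le> \<phi> (w m) - ?S m (w m)" if "1 \<le> m" "m \<le> K" for m
    using that
  proof (induction m rule: dec_induct)
    case base
    then show ?case using w(2)[of 1 ystar] ystar by (simp add: bregman_penalty_def y_0)
  next
    case (step m)
    have m: "m \<in> {1..K}" "Suc m \<in> {1..K}" using step by auto
    have "lam m * bregman r (y m) (w m) \<le> lam m * (eps m / Lam m)"
      using close[OF m(1)] assms(17)[of m] m(2) by (intro mult_left_mono) auto
    moreover have "\<phi> (w m) - ?S (Suc m) (w m) \<le> \<phi> (w (Suc m)) - ?S (Suc m) (w (Suc m))"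
      using w(2)[OF m(2) w(1)[OF m(1)]] .
    ultimately show ?case using step m by (simp add: bregman_penalty_def)
  qed
  have K: "K \<in> {1..K}" using assms(16) by simp
  have "0 \<le> ?S K (w K)"
    unfolding bregman_penalty_def using V assms(17)
    by (intro sum_nonneg mult_nonneg_nonneg) (auto simp: less_imp_le)
  then have val: "\<phi> ystar - \<phi> (w K) \<le> ?B" using telescope[of K] assms(16) by simp
  have "\<phi> ystar - \<phi> (y K) \<le> ?B + L * sqrt (2 / mu * (eps K / Lam K))"
    if L: "lipschitz_wrt N L Y \<phi>" for L
  proof -
    have yK: "y K \<in> Y" using run(3)[OF K] by (simp add: is_arg_max_def)
    have "mu / 2 * (N (y K - w K))\<^sup>2 \<le> eps K / Lam K"
      using bregman_ge_square[OF rd assms(14)] close[OF K] order_trans by blast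
    then have "2 / mu * (mu / 2 * (N (y K - w K))\<^sup>2) \<le> 2 / mu * (eps K / Lam K)"
      using assms(13) by (intro mult_left_mono) auto
    then have "(N (y K - w K))\<^sup>2 \<le> 2 / mu * (eps K / Lam K)" using assms(13) by simp
    then have "N (y K - w K) \<le> sqrt (2 / mu * (eps K / Lam K))" by (rule real_le_rsqrt)
    then have "L * N (y K - w K) \<le> L * sqrt (2 / mu * (eps K / Lam K))"
      using L by (intro mult_left_mono) (auto simp: lipschitz_wrt_def)
    moreover have "\<bar>\<phi> (y K) - \<phi> (w K)\<bar> \<le> L * N (y K - w K)"
      using L yK w(1)[OF K] by (simp add: lipschitz_wrt_def)
    ultimately show ?thesis using val by linarith
  qed
  then show ?thesis using w(1)[OF K] close[OF K] val by blast
qed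

end
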